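(* Let $F$ be a field and let $D$ be a central division algebra over $F$, i.e. a division ring with center $F$ such that $\dim_F D<\infty$. Then there exist $x,y\in D$ such that $F(xy-yx)$ is a maximal subfield of $D$.
   Context: A division algebra over a field $F$ is a division ring $D$ whose center $Z(D)=\{a\in D\mid ab=ba \text{ for all } b\in D\}$ equals $F$ and which is finite dimensional as an $F$-vector space. For $c\in D$, $F(c)$ denotes the subfield of $D$ generated by $F$ and $c$. A maximal subfield of $D$ is a subfield of $D$ that is maximal with respect to inclusion among the subfields (commutative division subrings) of $D$. *)

theory Defs
  imports Complex_Main
begin

definition ring_center :: "'a::ring_1 set" where
  "ring_center = {a. \<forall>b. a * b = b * a}"

text \<open>
  A division ring \<open>D\<close> (the type \<open>'a\<close>) that is an algebra over a field \<open>F\<close> (the type \<open>'f\<close>, acting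
  through \<open>scale\<close>). The field is identified with its copy in \<open>D\<close>, the set of all \<open>scale k 1\<close>; the
  identification is injective because \<open>1 \<noteq> 0\<close> in \<open>D\<close>.
\<close>

locale central_division_algebra = vector_space scale
  for scale :: "'f::field \<Rightarrow> 'a::division_ring \<Rightarrow> 'a" +
  assumes scale_mult_left: "scale k (a * b) = scale k a * b"
    and scale_mult_right: "scale k (a * b) = a * scale k b"
    and center_eq: "ring_center = range (\<lambda>k. scale k 1)"
    and finite_dim: "\<exists>B. finite_dimensional_vector_space scale B"

definition is_subfield :: "'a::division_ring set \<Rightarrow> bool" where
  "is_subfield K \<longleftrightarrow>
     0 \<in> K \<and> 1 \<in> K \<and>
     (\<forall>a\<in>K. \<forall>b\<in>K. a - b \<in> K \<and> a * b \<in> K) \<and>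
     (\<forall>a\<in>K. a \<noteq> 0 \<longrightarrow> inverse a \<in> K) \<and>
     (\<forall>a\<in>K. \<forall>b\<in>K. a * b = b * a)"

definition is_maximal_subfield :: "'a::division_ring set \<Rightarrow> bool" where
  "is_maximal_subfield K \<longleftrightarrow>
     is_subfield K \<and> (\<forall>L. is_subfield L \<longrightarrow> K \<subseteq> L \<longrightarrow> L = K)"

text \<open>
  The intersection below is over a nonempty family only if \<open>S\<close> is contained in some subfield, that
  is, if its elements commute pairwise. This always holds for the central field together with one
  further element.
\<close>

definition generated_subfield :: "'a::division_ring set \<Rightarrow> 'a set" where
  "generated_subfield S = \<Inter>{K. is_subfield K \<and> S \<subseteq> K}"

definition (in central_division_algebra) adjoin :: "'a \<Rightarrow> 'a set" where
  "adjoin c = generated_subfield (range (\<lambda>k. scale k 1) \<union> {c})"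

end

theory Submission
  imports Defs "HOL-Algebra.Multiplicative_Group" "Jordan_Normal_Form.Determinant"
begin

text \<open>
  Fix a maximal subfield \<open>K\<close> of \<open>D\<close> and regard \<open>D\<close> as a right vector space over \<open>K\<close>. If left
  multiplication by \<open>c\<close> has a cyclic vector \<open>v\<close>, every \<open>z\<close> commuting with \<open>c\<close> satisfies an identity
  \<open>z x = \<Sum> c\<^sup>i x k\<^sub>i\<close>, and such an identity puts \<open>z\<close> into the \<open>F\<close>-span of the powers of \<open>c\<close>. So
  \<open>F(c)\<close> is its own centralizer, and it is enough to find a commutator with a cyclic vector.

  If \<open>F\<close> is infinite: by density, all \<open>K\<close>-linear operators have the form \<open>x \<mapsto> \<Sum> a x k\<close>, and the
  shift operator is a commutator of two of them. Having \<open>v\<close> as a cyclic vector is the nonvanishing of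
  a determinant that is polynomial in each \<open>k\<close>, so the \<open>k\<close> can be replaced by elements of \<open>F\<close>.

  If \<open>F\<close> is finite, Wedderburn's theorem is not needed: \<open>K\<close> is cyclic over \<open>F\<close> and
  \<open>D = \<Sum> u\<^sup>i K\<close> for some \<open>u\<close> inducing a power of the Frobenius on \<open>K\<close>. For a generator \<open>a\<close> of
  the multiplicative group of \<open>K\<close>, the commutator \<open>a u - u a\<close> lies in \<open>u K\<close> and has cyclic vector \<open>1\<close>
  (unless it vanishes, and then \<open>D = K\<close>).
\<close>

subsection \<open>Centralizers and a maximal subfield\<close>

definition centralizer :: "'a::ring_1 set \<Rightarrow> 'a set" where
  "centralizer S = {x. \<forall>s\<in>S. x * s = s * x}"

lemma centralizer_closed:
  fixes S :: "'a::division_ring set"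
  shows "0 \<in> centralizer S" "1 \<in> centralizer S"
    and "x \<in> centralizer S \<Longrightarrow> y \<in> centralizer S \<Longrightarrow> x + y \<in> centralizer S"
    and "x \<in> centralizer S \<Longrightarrow> y \<in> centralizer S \<Longrightarrow> x - y \<in> centralizer S"
    and "x \<in> centralizer S \<Longrightarrow> - x \<in> centralizer S"
    and "x \<in> centralizer S \<Longrightarrow> y \<in> centralizer S \<Longrightarrow> x * y \<in> centralizer S"
    and "x \<in> centralizer S \<Longrightarrow> inverse x \<in> centralizer S"
proof -
  show "x * y \<in> centralizer S" if "x \<in> centralizer S" "y \<in> centralizer S" for x y
    using that by (simp add: centralizer_def) (metis mult.assoc)
  show "inverse x \<in> centralizer S" if "x \<in> centralizer S" for x
  proof (cases "x = 0")
    case False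
    have "inverse x * s = s * inverse x" if "s \<in> S" for s
    proof -
      have "x * s = s * x"
        using \<open>x \<in> centralizer S\<close> that by (simp add: centralizer_def)
      then have "inverse x * (x * s) * inverse x = inverse x * (s * x) * inverse x"
        by simp
      then show ?thesis
        using False by (simp add: mult.assoc) (metis left_inverse mult.assoc mult.left_neutral)
    qed
    then show ?thesis
      by (simp add: centralizer_def)
  qed (use that in simp)
qed (auto simp: centralizer_def algebra_simps)

text \<open>Pairwise commuting elements lie in their own centralizer. Taking centralizers reverses
  this inclusion, so the double centralizer lies in the centralizer and is commutative.\<close>

lemma is_subfield_double_centralizer:
  fixes S :: "'a::division_ring set"
  assumes "\<And>x y. x \<in> S \<Longrightarrow> y \<in> S \<Longrightarrow> x * y = y * x"
  shows "is_subfield (centralizer (centralizer S))"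
proof -
  have "S \<subseteq> centralizer S"
    using assms by (auto simp: centralizer_def)
  then have "centralizer (centralizer S) \<subseteq> centralizer S"
    by (auto simp: centralizer_def)
  then have "x * y = y * x"
    if "x \<in> centralizer (centralizer S)" "y \<in> centralizer (centralizer S)" for x y
    using that unfolding centralizer_def[of "centralizer S"] by blast
  then show ?thesis
    by (simp add: is_subfield_def centralizer_closed)
qed

lemma subset_double_centralizer: "S \<subseteq> centralizer (centralizer S)"
  by (auto simp: centralizer_def)

text \<open>Zorn's lemma gives a maximal pairwise commuting set; adjoining an element of its
  centralizer keeps it commuting, so that element was already a member.\<close>

lemma ex_self_centralizing: "\<exists>K :: 'a::ring_1 set. centralizer K = K"
proof -
  define A where "A = {K :: 'a set. \<forall>x\<in>K. \<forall>y\<in>K. x * y = y * x}"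
  have "\<exists>M\<in>A. \<forall>X\<in>A. M \<subseteq> X \<longrightarrow> X = M"
  proof (rule subset_Zorn')
    fix C assume C: "subset.chain A C"
    have "x * y = y * x" if "X \<in> C" "x \<in> X" "Y \<in> C" "y \<in> Y" for X Y x y
    proof -
      have "X \<subseteq> Y \<or> Y \<subseteq> X"
        using C that by (auto simp: subset.chain_def)
      moreover have "X \<in> A" "Y \<in> A"
        using C that by (auto simp: subset.chain_def)
      ultimately show ?thesis
        using that unfolding A_def by blast
    qed
    then show "\<Union>C \<in> A"
      by (auto simp: A_def)
  qed
  then obtain M where M: "M \<in> A" "\<And>X. X \<in> A \<Longrightarrow> M \<subseteq> X \<Longrightarrow> X = M"
    by blast
  have "x \<in> M" if "x \<in> centralizer M" for x
  proof -
    have "insert x M \<in> A"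
      using M(1) that by (auto simp: A_def centralizer_def)
    then show ?thesis
      using M(2)[of "insert x M"] by blast
  qed
  moreover have "M \<subseteq> centralizer M"
    using M(1) by (auto simp: A_def centralizer_def)
  ultimately show ?thesis
    by blast
qed

text \<open>In a division ring the self-centralizing subsets are exactly the maximal
  subfields.\<close>

definition max_comm :: "'a::ring_1 set" where
  "max_comm = (SOME K. centralizer K = K)"

lemma centralizer_max_comm: "centralizer max_comm = max_comm"
  unfolding max_comm_def by (rule someI_ex) (rule ex_self_centralizing)

lemma max_comm_closed:
  fixes x y :: "'a::division_ring"
  shows "(0::'a) \<in> max_comm" "(1::'a) \<in> max_comm"
    and "x \<in> max_comm \<Longrightarrow> y \<in> max_comm \<Longrightarrow> x + y \<in> max_comm"
    and "x \<in> max_comm \<Longrightarrow> y \<in> max_comm \<Longrightarrow> x - y \<in> max_comm"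
    and "x \<in> max_comm \<Longrightarrow> - x \<in> max_comm"
    and "x \<in> max_comm \<Longrightarrow> y \<in> max_comm \<Longrightarrow> x * y \<in> max_comm"
    and "x \<in> max_comm \<Longrightarrow> inverse x \<in> max_comm"
  using centralizer_closed[where S = "max_comm :: 'a set"] by (auto simp: centralizer_max_comm)

lemma max_comm_commute:
  fixes x y :: "'a::division_ring"
  assumes "x \<in> max_comm" "y \<in> max_comm"
  shows "x * y = y * x"
  using assms centralizer_max_comm unfolding centralizer_def by blast

text \<open>
  A maximal subfield of a division ring depends only on the ring, hence on its type, so it can be
  turned into a type of its own. This makes the library theory of vector spaces, polynomials and
  determinants over it available.
\<close>

typedef (overloaded) 'a maxfield = "max_comm :: 'a::division_ring set"
  morphisms of_maxfield Abs_maxfield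
  using max_comm_closed(1) by blast

setup_lifting type_definition_maxfield

instantiation maxfield :: (division_ring) field
begin

lift_definition zero_maxfield :: "'a maxfield" is 0 by (rule max_comm_closed)
lift_definition one_maxfield :: "'a maxfield" is 1 by (rule max_comm_closed)
lift_definition plus_maxfield :: "'a maxfield \<Rightarrow> 'a maxfield \<Rightarrow> 'a maxfield" is "(+)"
  by (rule max_comm_closed)
lift_definition minus_maxfield :: "'a maxfield \<Rightarrow> 'a maxfield \<Rightarrow> 'a maxfield" is "(-)"
  by (rule max_comm_closed)
lift_definition uminus_maxfield :: "'a maxfield \<Rightarrow> 'a maxfield" is uminus
  by (rule max_comm_closed)
lift_definition times_maxfield :: "'a maxfield \<Rightarrow> 'a maxfield \<Rightarrow> 'a maxfield" is "(*)"
  by (rule max_comm_closed)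
lift_definition inverse_maxfield :: "'a maxfield \<Rightarrow> 'a maxfield" is inverse
  by (rule max_comm_closed)

definition divide_maxfield :: "'a maxfield \<Rightarrow> 'a maxfield \<Rightarrow> 'a maxfield" where
  "divide_maxfield x y = x * inverse y"

instance
proof
  fix a b c :: "'a maxfield"
  show "a * b = b * a"
    by transfer (rule max_comm_commute)
  show "a div b = a * inverse b"
    by (simp add: divide_maxfield_def)
  show "a * b * c = a * (b * c)" "(a + b) * c = a * c + b * c"
    by (transfer; simp add: mult.assoc distrib_right)+
  show "a + b + c = a + (b + c)" "a + b = b + a"
    by (transfer; simp add: add.assoc add.commute)+
  show "1 * a = a" "0 + a = a" "- a + a = 0" "a - b = a + - b" "(0 :: 'a maxfield) \<noteq> 1"
    "inverse (0 :: 'a maxfield) = 0"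
    by (transfer; simp)+
  show "inverse a * a = 1" if "a \<noteq> 0"
    using that by transfer simp
qed

end

lemmas of_maxfield_simps [simp] =
  zero_maxfield.rep_eq one_maxfield.rep_eq plus_maxfield.rep_eq minus_maxfield.rep_eq
  uminus_maxfield.rep_eq times_maxfield.rep_eq inverse_maxfield.rep_eq

lemma of_maxfield_power [simp]: "of_maxfield (k ^ i) = of_maxfield k ^ i"
  by (induction i) simp_all

lemma of_maxfield_of_nat [simp]: "of_maxfield (of_nat i) = of_nat i"
  by (induction i) simp_all

text \<open>The standard way to show that an element lies in K: the centralizer of K is K.\<close>

lemma ex_of_maxfield:
  assumes "\<And>k :: 'a::division_ring maxfield. x * of_maxfield k = of_maxfield k * x"
  shows "\<exists>h. x = of_maxfield h"
proof -
  have "x * y = y * x" if "y \<in> max_comm" for y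
    using assms[of "Abs_maxfield y"] that by (simp add: Abs_maxfield_inverse)
  then have "x \<in> max_comm"
    by (subst centralizer_max_comm[symmetric]) (simp add: centralizer_def)
  then show ?thesis
    by (metis Abs_maxfield_inverse)
qed

lemma ring_center_of_maxfield:
  assumes "z \<in> ring_center"
  shows "\<exists>k. z = of_maxfield k"
  using assms by (intro ex_of_maxfield) (simp add: ring_center_def)

section \<open>D as a right vector space over K\<close>

definition rscale :: "'a::division_ring maxfield \<Rightarrow> 'a \<Rightarrow> 'a" where
  "rscale k x = x * of_maxfield k"

interpretation rvs: vector_space rscale
proof
  fix a b :: "'a maxfield" and x y :: 'a
  have "of_maxfield b * of_maxfield a = of_maxfield a * of_maxfield b"
    by (metis mult.commute times_maxfield.rep_eq)
  then show "rscale a (rscale b x) = rscale (a * b) x"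
    by (simp add: rscale_def mult.assoc)
qed (simp_all add: rscale_def distrib_left distrib_right)

abbreviation rlinear :: "('a::division_ring \<Rightarrow> 'a) \<Rightarrow> bool" where
  "rlinear \<equiv> Vector_Spaces.linear rscale rscale"

lemma rlinearI:
  assumes "\<And>x y. A (x + y) = A x + A y" "\<And>x k. A (x * of_maxfield k) = A x * of_maxfield k"
  shows "rlinear A"
  using assms
  by (simp add: Vector_Spaces.linear_iff_module_hom module_hom_iff rscale_def
        rvs.module_axioms)

lemma rlinear_simps:
  assumes "rlinear A"
  shows "A (x + y) = A x + A y" "A (x - y) = A x - A y" "A 0 = 0" "A (- x) = - A x"
    "A (x * of_maxfield k) = A x * of_maxfield k" "A (sum f I) = (\<Sum>i\<in>I. A (f i))"
proof -
  interpret Vector_Spaces.linear rscale rscale A by fact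
  show "A (x + y) = A x + A y" "A (x - y) = A x - A y" "A 0 = 0" "A (- x) = - A x"
    "A (x * of_maxfield k) = A x * of_maxfield k" "A (sum f I) = (\<Sum>i\<in>I. A (f i))"
    using scale[of k x] by (simp_all add: add diff zero neg sum rscale_def)
qed

lemma rlinear_mult_left: "rlinear (\<lambda>x. a * x)"
  by (rule rlinearI) (simp_all add: algebra_simps)

subsection \<open>Operators of the form \<open>x \<mapsto> \<Sum> a x k\<close>\<close>

text \<open>Built one summand at a time, so that the induction in \<open>krylov_det_bimult\<close>
  can treat a single coefficient \<open>k\<close> while the others stay fixed.\<close>

inductive_set bimult :: "('a::division_ring \<Rightarrow> 'a) set" where
  zero: "(\<lambda>x. 0) \<in> bimult"
| add: "T \<in> bimult \<Longrightarrow> (\<lambda>x. a * x * of_maxfield k + T x) \<in> bimult"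

lemma bimult_add:
  assumes "S \<in> bimult" "T \<in> bimult"
  shows "(\<lambda>x. S x + T x) \<in> bimult"
  using assms
proof (induction S)
  case (add S a k)
  then show ?case
    using bimult.add[of "\<lambda>x. S x + T x" a k] by (simp add: add.assoc)
qed simp

lemma bimult_mult_left:
  assumes "T \<in> bimult"
  shows "(\<lambda>x. b * T x) \<in> bimult"
  using assms
proof (induction T)
  case (add T a k)
  then show ?case
    using bimult.add[of "\<lambda>x. b * T x" "b * a" k] by (simp add: algebra_simps)
qed (simp add: bimult.zero)

lemma bimult_mult_right:
  assumes "T \<in> bimult"
  shows "(\<lambda>x. T x * of_maxfield h) \<in> bimult"
  using assms
proof (induction T)
  case (add T a k)
  then show ?case
    using bimult.add[of "\<lambda>x. T x * of_maxfield h" a "k * h"]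
    by (simp add: distrib_right mult.assoc)
qed (simp add: bimult.zero)

lemma bimult_diff:
  assumes "S \<in> bimult" "T \<in> bimult"
  shows "(\<lambda>x. S x - T x) \<in> bimult"
  using bimult_add[OF assms(1) bimult_mult_left[OF assms(2), of "-1"]] by simp

lemma bimult_sum:
  assumes "\<And>i. i \<in> I \<Longrightarrow> T i \<in> bimult"
  shows "(\<lambda>x. \<Sum>i\<in>I. T i x) \<in> bimult"
  using assms by (induction I rule: infinite_finite_induct) (simp_all add: bimult.zero bimult_add)

lemma bimult_id: "(\<lambda>x. x) \<in> bimult"
  using bimult.add[OF bimult.zero, of 1 1] by simp

lemma bimult_rlinear:
  assumes "T \<in> bimult"
  shows "rlinear T"
  using assms
proof induction
  case zero
  show ?case
    by (rule rlinearI) simp_all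
next
  case (add T a k)
  show ?case
  proof (rule rlinearI)
    fix x h
    have "of_maxfield h * of_maxfield k = of_maxfield k * of_maxfield h"
      by (simp add: mult.commute flip: times_maxfield.rep_eq)
    then show "a * (x * of_maxfield h) * of_maxfield k + T (x * of_maxfield h) =
        (a * x * of_maxfield k + T x) * of_maxfield h"
      by (simp add: rlinear_simps[OF add.IH] algebra_simps)
  qed (simp add: rlinear_simps[OF add.IH] algebra_simps)
qed

text \<open>
  The density theorem for the simple module \<open>D\<close> over the ring generated by left multiplications
  and by right multiplications with \<open>K\<close>: its endomorphisms are the right multiplications with
  the centralizer of \<open>K\<close>, that is, with \<open>K\<close> itself.
\<close>

lemma bimult_separates:
  assumes "finite S" "v \<notin> rvs.span S"
  shows "\<exists>T\<in>bimult. (\<forall>s\<in>S. T s = 0) \<and> T v \<noteq> 0"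
  using assms
proof (induction S arbitrary: v rule: finite_induct)
  case empty
  then show ?case
    using bimult_id by auto
next
  case (insert u S)
  let ?I = "{T \<in> bimult. \<forall>s\<in>S. T s = 0}"
  show ?case
  proof (cases "u \<in> rvs.span S")
    case True
    then have "rvs.span (insert u S) = rvs.span S"
      by (rule rvs.span_redundant)
    then obtain T where T: "T \<in> ?I" "T v \<noteq> 0"
      using insert.IH[of v] insert.prems by auto
    interpret T: Vector_Spaces.linear rscale rscale T
      using T(1) by (simp add: bimult_rlinear)
    have "T u = 0"
      using T.eq_0_on_span[of S u] T(1) True by simp
    then show ?thesis
      using T by blast
  next
    case False
    then obtain T where T: "T \<in> ?I" "T u \<noteq> 0"
      using insert.IH[of u] by blast
    \<comment> \<open>Scaling to \<open>E u = 1\<close> lets left multiples of \<open>E\<close>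
      cancel the value of any operator at \<open>u\<close>.\<close>
    define E where "E = (\<lambda>x. inverse (T u) * T x)"
    have E: "E \<in> ?I" "E u = 1"
      using T by (auto simp: E_def bimult_mult_left)
    show ?thesis
    proof (rule ccontr)
      assume "\<not> ?thesis"
      then have *: "T v = 0" if "T \<in> ?I" "T u = 0" for T
        using that by blast
      \<comment> \<open>The difference of the right and the left multiple of \<open>E\<close> by
        \<open>k\<close> kills \<open>S\<close> and \<open>u\<close>, hence also \<open>v\<close>;
        so \<open>E v\<close> commutes with K and lies in K.\<close>
      have "E v * of_maxfield k = of_maxfield k * E v" for k
      proof -
        have "(\<lambda>x. E x * of_maxfield k - of_maxfield k * E x) \<in> ?I"
          using E bimult_diff[OF bimult_mult_right bimult_mult_left, of E E k "of_maxfield k"]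
          by simp
        from *[OF this] show ?thesis
          using E by simp
      qed
      then obtain d where d: "E v = of_maxfield d"
        using ex_of_maxfield by blast
      \<comment> \<open>Subtracting \<open>T u * E x\<close> makes \<open>T\<close> vanish at
        \<open>u\<close> too, hence at \<open>v\<close>. As no operator killing \<open>S\<close>
        detects \<open>v - u * of_maxfield d\<close>, the induction hypothesis puts this vector into
        the span of \<open>S\<close>.\<close>
      have "T (v - u * of_maxfield d) = 0" if T: "T \<in> ?I" for T
      proof -
        have "(\<lambda>x. T x - T u * E x) \<in> ?I"
          using E T bimult_diff[OF _ bimult_mult_left, of T E "T u"] by simp
        from *[OF this] have "T v = T u * E v"
          using E by simp
        moreover have "rlinear T"
          using T by (simp add: bimult_rlinear)
        ultimately show ?thesis
          by (simp add: rlinear_simps d)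
      qed
      then have "v - u * of_maxfield d \<in> rvs.span S"
        using insert.IH by blast
      then have "v - rscale d u \<in> rvs.span S"
        by (simp add: rscale_def)
      then have "v \<in> rvs.span (insert u S)"
        unfolding rvs.span_insert by blast
      then show False
        using insert.prems by blast
    qed
  qed
qed

text \<open>As in Lagrange interpolation: an operator killing the other members of \<open>B\<close>
  is scaled to take the value \<open>g b\<close> at \<open>b\<close>, and these operators are
  summed.\<close>

lemma bimult_interpolate:
  fixes g :: "'a::division_ring \<Rightarrow> 'a"
  assumes "finite B" "rvs.independent B"
  shows "\<exists>T\<in>bimult. \<forall>b\<in>B. T b = g b"
proof -
  have "\<exists>T. T \<in> bimult \<and> (\<forall>s\<in>B. T s = (if s = b then g b else 0))" if "b \<in> B" for b
  proof -
    have "b \<notin> rvs.span (B - {b})"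
      using assms(2) that by (auto simp: rvs.dependent_def)
    then obtain T where T: "T \<in> bimult" "\<forall>s\<in>B - {b}. T s = 0" "T b \<noteq> 0"
      using bimult_separates[of "B - {b}" b] assms(1) by blast
    have "(\<lambda>x. g b * inverse (T b) * T x) \<in> bimult"
      by (rule bimult_mult_left) (rule T(1))
    moreover have "g b * inverse (T b) * T s = (if s = b then g b else 0)" if "s \<in> B" for s
      using T that by (simp add: mult.assoc)
    ultimately show ?thesis
      by (intro exI[of _ "\<lambda>x. g b * inverse (T b) * T x"] conjI ballI)
  qed
  then have "\<forall>b. \<exists>T. b \<in> B \<longrightarrow> T \<in> bimult \<and> (\<forall>s\<in>B. T s = (if s = b then g b else 0))"
    by blast
  from choice[OF this] obtain T where
    *: "\<forall>b. b \<in> B \<longrightarrow> T b \<in> bimult \<and> (\<forall>s\<in>B. T b s = (if s = b then g b else 0))" ..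
  then have T: "\<And>b. b \<in> B \<Longrightarrow> T b \<in> bimult"
    "\<And>b s. b \<in> B \<Longrightarrow> s \<in> B \<Longrightarrow> T b s = (if s = b then g b else 0)"
    by simp_all
  have "(\<Sum>b\<in>B. T b s) = g s" if "s \<in> B" for s
  proof -
    have "(\<Sum>b\<in>B. T b s) = (\<Sum>b\<in>B. if s = b then g b else 0)"
      by (rule sum.cong[OF refl]) (simp add: T(2) that)
    then show ?thesis
      using assms(1) that by simp
  qed
  moreover have "(\<lambda>x. \<Sum>b\<in>B. T b x) \<in> bimult"
    by (rule bimult_sum) (rule T(1))
  ultimately show ?thesis
    by (intro bexI[of _ "\<lambda>x. \<Sum>b\<in>B. T b x"] ballI)
qed

subsection \<open>A cyclic vector forces a maximal subfield\<close>

text \<open>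
  The independence theorem of Artin and Whaples, without assuming the \<open>a i\<close> to be independent:
  if some \<open>b i\<close> does not commute with \<open>y\<close>, comparing \<open>z (x y)\<close> with \<open>(z x) y\<close> eliminates \<open>a i\<close>.
\<close>

lemma left_mult_eq_sum:
  fixes a b :: "'i \<Rightarrow> 'a::division_ring"
  assumes "finite I" "\<And>x. z * x = (\<Sum>i\<in>I. a i * x * b i)"
  shows "\<exists>f. range f \<subseteq> ring_center \<and> z = (\<Sum>i\<in>I. a i * f i)"
  using assms
proof (induction I arbitrary: b rule: finite_psubset_induct)
  case (psubset I)
  note z = psubset.prems
  show ?case
  proof (cases "\<forall>i\<in>I. b i \<in> ring_center")
    case True
    \<comment> \<open>The default 0 outside \<open>I\<close> makes the whole range of the
      coefficient function central.\<close>
    have "z = (\<Sum>i\<in>I. a i * (if i \<in> I then b i else 0))"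
      using z[of 1] by simp
    moreover have "range (\<lambda>i. if i \<in> I then b i else 0) \<subseteq> ring_center"
      using True by (auto simp: ring_center_def)
    ultimately show ?thesis
      by (intro exI[of _ "\<lambda>i. if i \<in> I then b i else 0"] conjI)
  next
    case False
    then obtain j y where j: "j \<in> I" and y: "b j * y \<noteq> y * b j"
      by (auto simp: ring_center_def)
    define g where "g = (\<lambda>i. y * b i - b i * y)"
    \<comment> \<open>Chosen so that \<open>h j = 0\<close>: a right multiple of the relation with
      coefficients \<open>g\<close> cancels the term at \<open>j\<close>.\<close>
    define h where "h = (\<lambda>i. b i - g i * inverse (g j) * b j)"
    have "g j \<noteq> 0"
      using y by (simp add: g_def)
    have "z * x = (\<Sum>i\<in>I - {j}. a i * x * h i)" for x
    proof -
      have "(\<Sum>i\<in>I. a i * x * g i) = z * (x * y) - z * x * y"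
        unfolding z by (simp add: g_def sum_distrib_right mult.assoc right_diff_distrib sum_subtractf)
      then have "(\<Sum>i\<in>I. a i * x * g i) = 0"
        by (simp add: mult.assoc)
      then have "a j * x * g j = - (\<Sum>i\<in>I - {j}. a i * x * g i)"
        using j psubset.hyps by (simp add: sum.remove[of I j] eq_neg_iff_add_eq_0)
      then have "a j * x * g j * inverse (g j) * b j =
          - (\<Sum>i\<in>I - {j}. a i * x * g i) * inverse (g j) * b j"
        by simp
      moreover have "a j * x * g j * inverse (g j) * b j = a j * x * b j"
        using \<open>g j \<noteq> 0\<close> by (metis mult.assoc mult.right_neutral right_inverse)
      ultimately have *: "a j * x * b j = - (\<Sum>i\<in>I - {j}. a i * x * (g i * inverse (g j) * b j))"
        by (simp add: sum_distrib_right mult.assoc)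
      have "z * x = a j * x * b j + (\<Sum>i\<in>I - {j}. a i * x * b i)"
        unfolding z using j psubset.hyps by (simp add: sum.remove[of I j])
      also have "\<dots> = (\<Sum>i\<in>I - {j}. a i * x * h i)"
        unfolding * by (simp add: h_def right_diff_distrib sum_subtractf)
      finally show ?thesis .
    qed
    moreover have "I - {j} \<subset> I"
      using j by blast
    ultimately obtain f where f: "range f \<subseteq> ring_center" "z = (\<Sum>i\<in>I - {j}. a i * f i)"
      using psubset.IH[of "I - {j}" h] by blast
    have "z = (\<Sum>i\<in>I. a i * (f(j := 0)) i)"
      using j psubset.hyps f(2) by (simp add: sum.remove[of I j])
    moreover have "range (f(j := 0)) \<subseteq> ring_center"
      using f(1) by (auto simp: ring_center_def)
    ultimately show ?thesis
      by (intro exI[of _ "f(j := 0)"] conjI)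
  qed
qed

lemma rvs_span_range:
  assumes "x \<in> rvs.span (range w)"
  shows "\<exists>l. x = (\<Sum>(i, k)\<leftarrow>l. w i * of_maxfield k)"
  using assms
proof (induction rule: rvs.span_induct_alt)
  case base
  show ?case
    by (intro exI[of _ "[]"]) simp
next
  case (step k u x)
  then obtain i l where "u = w i" "x = (\<Sum>(i, k)\<leftarrow>l. w i * of_maxfield k)"
    by blast
  then show ?case
    by (intro exI[of _ "(i, k) # l"]) (simp add: rscale_def)
qed

lemma is_subfieldD:
  assumes "is_subfield L"
  shows "0 \<in> L" "1 \<in> L" "x \<in> L \<Longrightarrow> y \<in> L \<Longrightarrow> x + y \<in> L" "x \<in> L \<Longrightarrow> y \<in> L \<Longrightarrow> x - y \<in> L"
    "x \<in> L \<Longrightarrow> y \<in> L \<Longrightarrow> x * y \<in> L" "x \<in> L \<Longrightarrow> x \<noteq> 0 \<Longrightarrow> inverse x \<in> L"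
    "x \<in> L \<Longrightarrow> y \<in> L \<Longrightarrow> x * y = y * x"
proof -
  have diff: "x - y \<in> L" if "x \<in> L" "y \<in> L" for x y
    using assms that unfolding is_subfield_def by blast
  then show "x \<in> L \<Longrightarrow> y \<in> L \<Longrightarrow> x - y \<in> L" .
  show zero: "0 \<in> L"
    using assms unfolding is_subfield_def by blast
  show "x + y \<in> L" if "x \<in> L" "y \<in> L"
    using diff[OF that(1) diff[OF zero that(2)]] by simp
qed (use assms in \<open>unfold is_subfield_def, blast+\<close>)

lemma is_subfield_sum:
  assumes "is_subfield L" "\<And>i. i \<in> I \<Longrightarrow> f i \<in> L"
  shows "sum f I \<in> L"
  using assms(2)
  by (induction I rule: infinite_finite_induct) (simp_all add: is_subfieldD[OF assms(1)])

lemma is_subfield_power: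
  assumes "is_subfield L" "x \<in> L"
  shows "x ^ i \<in> L"
  using assms(2) by (induction i) (simp_all add: is_subfieldD(2,5)[OF assms(1)])

lemma is_subfield_Inter:
  assumes "\<F> \<noteq> {}" "\<And>L. L \<in> \<F> \<Longrightarrow> is_subfield L"
  shows "is_subfield (\<Inter>\<F>)"
  unfolding is_subfield_def
proof (intro conjI ballI impI)
  obtain L where "L \<in> \<F>"
    using assms(1) by blast
  fix a b assume "a \<in> \<Inter>\<F>" "b \<in> \<Inter>\<F>"
  then show "a * b = b * a"
    using is_subfieldD(7)[OF assms(2)[OF \<open>L \<in> \<F>\<close>]] \<open>L \<in> \<F>\<close> by blast
qed (use is_subfieldD(1-6)[OF assms(2)] in \<open>simp_all\<close>)

text \<open>Write \<open>z * v\<close> as a sum of terms \<open>c ^ i * v * k\<close>. Replacing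
  \<open>v\<close> by a variable gives an operator that, like left multiplication by
  \<open>z\<close>, is K-linear and commutes with \<open>c\<close>. The two agree at
  \<open>v\<close>, hence at all \<open>c ^ i * v\<close>, hence everywhere, and
  \<open>left_mult_eq_sum\<close> applies.\<close>

lemma centralizer_eq_sum_powers:
  fixes c v :: "'a::division_ring"
  assumes span: "rvs.span (range (\<lambda>i. c ^ i * v)) = UNIV" and z: "z * c = c * z"
  shows "\<exists>(m::nat) e f. range f \<subseteq> ring_center \<and> z = (\<Sum>i<m. c ^ e i * f i)"
proof -
  obtain l where l: "z * v = (\<Sum>(i, k)\<leftarrow>l. c ^ i * v * of_maxfield k)"
    using rvs_span_range[of "z * v" "\<lambda>i. c ^ i * v"] span by auto
  define e where "e = (\<lambda>j. fst (l ! j))"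
  define b where "b = (\<lambda>j. snd (l ! j))"
  define T where "T = (\<lambda>x. \<Sum>j<length l. c ^ e j * x * of_maxfield (b j))"
  have Tv: "T v = z * v"
    unfolding l T_def by (simp add: sum_list_sum_nth atLeast0LessThan case_prod_beta e_def b_def)
  have T_c: "T (c ^ i * x) = c ^ i * T x" for i x
    unfolding T_def sum_distrib_left
  proof (rule sum.cong[OF refl])
    fix j
    have "c ^ e j * c ^ i = c ^ i * c ^ e j"
      by (metis add.commute power_add)
    then show "c ^ e j * (c ^ i * x) * of_maxfield (b j) = c ^ i * (c ^ e j * x * of_maxfield (b j))"
      by (metis mult.assoc)
  qed
  have T_add: "T (x + y) = T x + T y" for x y
    by (simp add: T_def distrib_left distrib_right sum.distrib)
  have T_scale: "T (x * of_maxfield k) = T x * of_maxfield k" for x k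
    unfolding T_def sum_distrib_right
  proof (rule sum.cong[OF refl])
    fix j
    have "of_maxfield k * of_maxfield (b j) = of_maxfield (b j) * of_maxfield k"
      by (metis mult.commute times_maxfield.rep_eq)
    then show "c ^ e j * (x * of_maxfield k) * of_maxfield (b j) =
        c ^ e j * x * of_maxfield (b j) * of_maxfield k"
      by (simp add: mult.assoc)
  qed
  have "rlinear (\<lambda>x. z * x - T x)"
    by (rule rlinearI) (simp_all add: T_add T_scale distrib_left left_diff_distrib mult.assoc)
  then interpret D: Vector_Spaces.linear rscale rscale "\<lambda>x. z * x - T x" .
  have "z * c ^ i = c ^ i * z" for i
    by (rule power_commuting_commutes[OF z[symmetric], symmetric])
  then have "z * (c ^ i * v) - T (c ^ i * v) = 0" for i
    by (simp add: T_c Tv flip: mult.assoc)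
  then have "z * x - T x = 0" for x
    using D.eq_0_on_span[of "range (\<lambda>i. c ^ i * v)" x] span by auto
  then have "z * x = (\<Sum>j<length l. c ^ e j * x * of_maxfield (b j))" for x
    by (simp add: T_def)
  from left_mult_eq_sum[OF finite_lessThan this] obtain f
    where "range f \<subseteq> ring_center" "z = (\<Sum>j<length l. c ^ e j * f j)"
    by blast
  then show ?thesis
    by (intro exI[of _ "length l"] exI[of _ e] exI[of _ f] conjI)
qed

text \<open>A larger subfield commutes with \<open>c\<close>, so its elements are sums of powers of
  \<open>c\<close> with central coefficients, and these lie in every subfield containing the center
  and \<open>c\<close>.\<close>

lemma (in central_division_algebra) is_maximal_subfield_adjoin:
  assumes span: "rvs.span (range (\<lambda>i. c ^ i * v)) = UNIV"
  shows "is_maximal_subfield (adjoin c)"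
proof -
  define \<F> where "\<F> = {L. is_subfield L \<and> ring_center \<union> {c} \<subseteq> L}"
  have adjoin: "adjoin c = \<Inter>\<F>"
    by (simp add: adjoin_def generated_subfield_def center_eq \<F>_def)
  \<comment> \<open>This witness shows that the intersection defining \<open>adjoin c\<close> is
    over a nonempty family.\<close>
  have "is_subfield (centralizer (centralizer (ring_center \<union> {c})))"
    by (rule is_subfield_double_centralizer) (auto simp: ring_center_def)
  then have "centralizer (centralizer (ring_center \<union> {c})) \<in> \<F>"
    using subset_double_centralizer[of "ring_center \<union> {c}"] by (simp add: \<F>_def)
  then have "is_subfield (adjoin c)"
    unfolding adjoin by (intro is_subfield_Inter) (auto simp: \<F>_def)
  moreover have "L \<subseteq> adjoin c" if L: "is_subfield L" "adjoin c \<subseteq> L" for L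
  proof
    fix z assume "z \<in> L"
    have "c \<in> L"
      using L(2) by (auto simp: adjoin \<F>_def)
    with \<open>z \<in> L\<close> have "z * c = c * z"
      by (rule is_subfieldD(7)[OF L(1)])
    from centralizer_eq_sum_powers[OF span this] obtain m e f
      where f: "range f \<subseteq> ring_center" and z: "z = (\<Sum>i<(m::nat). c ^ e i * f i)"
      by blast
    have "c ^ e i * f i \<in> M" if "M \<in> \<F>" for M i
    proof -
      have M: "is_subfield M" "c \<in> M" "f i \<in> M"
        using that f by (auto simp: \<F>_def)
      then show ?thesis
        by (intro is_subfieldD(5) is_subfield_power)
    qed
    then have "z \<in> M" if "M \<in> \<F>" for M
      unfolding z using that by (intro is_subfield_sum) (auto simp: \<F>_def)
    then show "z \<in> adjoin c"
      by (simp add: adjoin)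
  qed
  ultimately show ?thesis
    unfolding is_maximal_subfield_def by blast
qed

subsection \<open>Specialization over an infinite center\<close>

text \<open>A pointwise notion: closure under sums and products handles the Leibniz formula without
  matrices over a polynomial ring.\<close>

definition polyfun :: "('k::comm_ring_1 \<Rightarrow> 'k) \<Rightarrow> bool" where
  "polyfun f \<longleftrightarrow> (\<exists>p. \<forall>t. f t = poly p t)"

lemma polyfunI: "(\<And>t. f t = poly p t) \<Longrightarrow> polyfun f"
  by (auto simp: polyfun_def)

lemma polyfunE:
  assumes "polyfun f"
  obtains p where "\<And>t. f t = poly p t"
  using assms by (auto simp: polyfun_def)

lemma polyfun_const: "polyfun (\<lambda>t. c)"
  by (rule polyfunI[of _ "[:c:]"]) simp

lemma polyfun_ident: "polyfun (\<lambda>t. t)"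
  by (rule polyfunI[of _ "[:0, 1:]"]) simp

lemma polyfun_add:
  assumes "polyfun f" "polyfun g"
  shows "polyfun (\<lambda>t. f t + g t)"
proof -
  obtain p q where "\<And>t. f t = poly p t" "\<And>t. g t = poly q t"
    using assms by (auto elim!: polyfunE)
  then show ?thesis
    by (intro polyfunI[of _ "p + q"]) simp
qed

lemma polyfun_mult:
  assumes "polyfun f" "polyfun g"
  shows "polyfun (\<lambda>t. f t * g t)"
proof -
  obtain p q where "\<And>t. f t = poly p t" "\<And>t. g t = poly q t"
    using assms by (auto elim!: polyfunE)
  then show ?thesis
    by (intro polyfunI[of _ "p * q"]) simp
qed

lemma polyfun_sum:
  assumes "\<And>i. i \<in> I \<Longrightarrow> polyfun (f i)"
  shows "polyfun (\<lambda>t. \<Sum>i\<in>I. f i t)"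
  using assms
  by (induction I rule: infinite_finite_induct) (simp_all add: polyfun_const polyfun_add)

lemma polyfun_prod:
  assumes "\<And>i. i \<in> I \<Longrightarrow> polyfun (f i)"
  shows "polyfun (\<lambda>t. \<Prod>i\<in>I. f i t)"
  using assms
  by (induction I rule: infinite_finite_induct) (simp_all add: polyfun_const polyfun_mult)

lemma polyfun_finite_zeros:
  fixes f :: "'k::field \<Rightarrow> 'k"
  assumes "polyfun f" "f a \<noteq> 0"
  shows "finite {t. f t = 0}"
proof -
  obtain p where p: "\<And>t. f t = poly p t"
    using assms(1) by (auto elim: polyfunE)
  then have "p \<noteq> 0"
    using assms(2) by auto
  then show ?thesis
    unfolding p by (rule poly_roots_finite)
qed

section \<open>Coordinates over K and Krylov determinants\<close>

locale right_basis =
  fixes v :: "nat \<Rightarrow> 'a::division_ring" and n :: nat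
  assumes inj_v: "inj_on v {..<n}"
    and independent_v: "rvs.independent (v ` {..<n})"
    and span_v: "rvs.span (v ` {..<n}) = UNIV"
begin

definition coord :: "nat \<Rightarrow> 'a \<Rightarrow> 'a maxfield" where
  "coord j x = rvs.representation (v ` {..<n}) x (v j)"

lemma coord_add: "coord j (x + y) = coord j x + coord j y"
  unfolding coord_def by (simp add: rvs.representation_add[OF independent_v] span_v)

lemma coord_scale: "coord j (x * of_maxfield k) = k * coord j x"
  unfolding coord_def rscale_def[symmetric]
  by (simp add: rvs.representation_scale[OF independent_v] span_v)

lemma coord_zero: "coord j 0 = 0"
  using coord_scale[of j 0 0] by simp

lemma coord_sum: "coord j (\<Sum>i\<in>I. f i) = (\<Sum>i\<in>I. coord j (f i))"
  by (induction I rule: infinite_finite_induct) (simp_all add: coord_zero coord_add)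

lemma coord_basis: "i < n \<Longrightarrow> j < n \<Longrightarrow> coord j (v i) = (if i = j then 1 else 0)"
  unfolding coord_def
  by (subst rvs.representation_basis[OF independent_v]) (auto dest: inj_onD[OF inj_v])

lemma coord_expand: "x = (\<Sum>j<n. v j * of_maxfield (coord j x))"
proof -
  have "(\<Sum>b\<in>v ` {..<n}. rscale (rvs.representation (v ` {..<n}) x b) b) = x"
    by (rule rvs.sum_representation_eq[OF independent_v]) (simp_all add: span_v)
  then show ?thesis
    by (simp add: sum.reindex[OF inj_v] coord_def rscale_def)
qed

lemma coord_eqI: "(\<And>j. j < n \<Longrightarrow> coord j x = coord j y) \<Longrightarrow> x = y"
  by (subst coord_expand[of x], subst coord_expand[of y]) (rule sum.cong; simp)

lemma coord_rlinear:
  assumes "rlinear A"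
  shows "coord l (A x) = (\<Sum>j<n. coord j x * coord l (A (v j)))"
proof -
  have "A x = (\<Sum>j<n. A (v j) * of_maxfield (coord j x))"
    by (subst coord_expand[of x]) (simp only: rlinear_simps[OF assms])
  then show ?thesis
    by (simp only: coord_sum coord_scale)
qed

text \<open>The rows are the coordinates of \<open>v 0\<close> and its first iterates under
  \<open>C\<close>. For K-linear \<open>C\<close> the determinant is nonzero exactly when
  \<open>v 0\<close> is a cyclic vector.\<close>

definition krylov_det :: "('a \<Rightarrow> 'a) \<Rightarrow> 'a maxfield" where
  "krylov_det C = det (mat n n (\<lambda>(i, j). coord j ((C ^^ i) (v 0))))"

text \<open>By induction on \<open>i\<close>, the coordinates of the \<open>i\<close>-th iterate are
  polynomial in \<open>t\<close>, since one more step combines them with constants and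
  \<open>t\<close>. The Leibniz formula passes this on to the determinant.\<close>

lemma polyfun_krylov_det:
  assumes A: "rlinear A" and B: "rlinear B"
  shows "polyfun (\<lambda>t. krylov_det (\<lambda>x. A x + B x * of_maxfield t))"
proof -
  have *: "polyfun (\<lambda>t. coord j (((\<lambda>x. A x + B x * of_maxfield t) ^^ i) (v 0)))" for i j
  proof (induction i arbitrary: j)
    case 0
    show ?case
      by (simp add: polyfun_const)
  next
    case (Suc i)
    let ?w = "\<lambda>t. ((\<lambda>x. A x + B x * of_maxfield t) ^^ i) (v 0)"
    have "polyfun (\<lambda>t. (\<Sum>l<n. coord l (?w t) * coord j (A (v l))) +
        t * (\<Sum>l<n. coord l (?w t) * coord j (B (v l))))"
      by (intro polyfun_add polyfun_mult polyfun_sum polyfun_ident polyfun_const Suc)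
    moreover have "coord j (((\<lambda>x. A x + B x * of_maxfield t) ^^ Suc i) (v 0)) =
        (\<Sum>l<n. coord l (?w t) * coord j (A (v l))) +
        t * (\<Sum>l<n. coord l (?w t) * coord j (B (v l)))" for t
      by (simp only: funpow.simps o_def coord_add coord_scale coord_rlinear[OF A, of j "?w t"]
          coord_rlinear[OF B, of j "?w t"])
    ultimately show ?case
      by (simp only:)
  qed
  have "polyfun (\<lambda>t. \<Sum>p\<in>{p. p permutes {0..<n}}. signof p *
      (\<Prod>i = 0..<n. coord (p i) (((\<lambda>x. A x + B x * of_maxfield t) ^^ i) (v 0))))"
    by (intro polyfun_sum polyfun_mult polyfun_prod polyfun_const *)
  moreover have "p i < n" if "p permutes {0..<n}" "i < n" for p i
    using permutes_in_image[OF that(1), of i] that(2) by simp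
  then have "krylov_det C = (\<Sum>p\<in>{p. p permutes {0..<n}}. signof p *
      (\<Prod>i = 0..<n. coord (p i) ((C ^^ i) (v 0))))" for C
    unfolding krylov_det_def
    by (subst det_def'[of _ n]) (auto intro!: sum.cong prod.cong)
  ultimately show ?thesis
    by simp
qed

text \<open>A polynomial function that is nonzero at \<open>k\<close> has finitely many zeros, while
  the center supplies infinitely many arguments.\<close>

lemma krylov_det_specialize:
  assumes "infinite (ring_center :: 'a set)" "rlinear A" "rlinear B"
    and "krylov_det (\<lambda>x. A x + B x * of_maxfield k) \<noteq> 0"
  shows "\<exists>h. of_maxfield h \<in> ring_center \<and> krylov_det (\<lambda>x. A x + B x * of_maxfield h) \<noteq> 0"
proof -
  let ?g = "\<lambda>t. krylov_det (\<lambda>x. A x + B x * of_maxfield t)"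
  have "ring_center \<subseteq> of_maxfield ` {h :: 'a maxfield. of_maxfield h \<in> ring_center}"
    using ring_center_of_maxfield by blast
  then have "infinite {h :: 'a maxfield. of_maxfield h \<in> ring_center}"
    using assms(1) finite_subset by blast
  moreover have "finite {t. ?g t = 0}"
    by (rule polyfun_finite_zeros[OF polyfun_krylov_det]) (fact assms)+
  ultimately have "\<not> {h :: 'a maxfield. of_maxfield h \<in> ring_center} \<subseteq> {t. ?g t = 0}"
    using finite_subset by blast
  then show ?thesis
    by auto
qed

section \<open>Commutators of operators\<close>

definition op_commutator :: "('a \<Rightarrow> 'a) \<Rightarrow> ('a \<Rightarrow> 'a) \<Rightarrow> 'a \<Rightarrow> 'a" where
  "op_commutator X Y = (\<lambda>x. X (Y x) - Y (X x))"

lemma rlinear_op_commutator: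
  assumes "rlinear X" "rlinear Y"
  shows "rlinear (op_commutator X Y)"
  by (rule rlinearI)
     (simp_all add: op_commutator_def rlinear_simps[OF assms(1)] rlinear_simps[OF assms(2)] algebra_simps)

text \<open>
  The coefficients \<open>k\<close> of an operator \<open>x \<mapsto> \<Sum> a x k\<close> are specialized to central elements
  one at a time; once all are central, the operator is a left multiplication.
\<close>

lemma krylov_det_bimult:
  assumes inf: "infinite (ring_center :: 'a set)"
    and "T \<in> bimult" "rlinear X" "rlinear Y"
    and "krylov_det (op_commutator (\<lambda>x. X x + T x) Y) \<noteq> 0"
  shows "\<exists>d. krylov_det (op_commutator (\<lambda>x. X x + d * x) Y) \<noteq> 0"
  using assms(2-)
proof (induction T arbitrary: X)
  case zero
  then show ?case
    by (intro exI[of _ 0]) simp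
next
  case (add T a k)
  note Y = rlinear_simps[OF add.prems(2)]
  let ?A = "op_commutator (\<lambda>x. X x + T x) Y"
  let ?B = "op_commutator (\<lambda>x. a * x) Y"
  have "rlinear (\<lambda>x. X x + T x)"
    by (rule rlinearI) (simp_all add: rlinear_simps[OF add.prems(1)]
      rlinear_simps[OF bimult_rlinear[OF add.hyps]] distrib_right)
  then have "rlinear ?A"
    by (rule rlinear_op_commutator[OF _ add.prems(2)])
  moreover have "rlinear ?B"
    by (intro rlinear_op_commutator rlinear_mult_left add.prems)
  \<comment> \<open>The commutator is affine in \<open>k\<close> because \<open>Y\<close> commutes
    with right multiplication by \<open>k\<close>.\<close>
  moreover have "op_commutator (\<lambda>x. X x + (a * x * of_maxfield k + T x)) Y =
      (\<lambda>x. ?A x + ?B x * of_maxfield k)"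
    by (rule ext) (simp add: op_commutator_def Y left_diff_distrib)
  ultimately have "\<exists>h. of_maxfield h \<in> ring_center \<and>
      krylov_det (\<lambda>x. ?A x + ?B x * of_maxfield h) \<noteq> 0"
    using krylov_det_specialize[OF inf, of ?A ?B k] add.prems(3) by simp
  then obtain h where h: "of_maxfield h \<in> (ring_center :: 'a set)"
    "krylov_det (\<lambda>x. ?A x + ?B x * of_maxfield h) \<noteq> 0"
    by (elim exE conjE)
  have comm: "of_maxfield h * x = x * of_maxfield h" for x
    using h(1) by (simp add: ring_center_def)
  \<comment> \<open>A central coefficient moves to the left, so the specialized summand is a left
    multiplication and can be absorbed into \<open>X\<close> for the induction hypothesis.\<close>
  have "op_commutator (\<lambda>x. X x + of_maxfield h * a * x + T x) Y = (\<lambda>x. ?A x + ?B x * of_maxfield h)"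
  proof
    fix x
    have "of_maxfield h * a * y = a * y * of_maxfield h" for y
      using comm[of "a * y"] by (simp add: mult.assoc)
    then show "op_commutator (\<lambda>x. X x + of_maxfield h * a * x + T x) Y x = ?A x + ?B x * of_maxfield h"
      by (simp add: op_commutator_def Y left_diff_distrib)
  qed
  moreover have "rlinear (\<lambda>x. X x + of_maxfield h * a * x)"
    by (rule rlinearI) (simp_all add: rlinear_simps[OF add.prems(1)] distrib_left distrib_right mult.assoc)
  ultimately obtain d where
    "krylov_det (op_commutator (\<lambda>x. X x + of_maxfield h * a * x + d * x) Y) \<noteq> 0"
    using add.IH[of "\<lambda>x. X x + of_maxfield h * a * x"] add.prems(2) h(2) by auto
  then show ?case
    by (intro exI[of _ "of_maxfield h * a + d"]) (simp add: distrib_right add.assoc)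
qed

text \<open>
  With \<open>X\<close> diagonal with entries \<open>0, 1, 2, \<dots>\<close> and \<open>Y\<close> the shift, \<open>[X, Y] = Y\<close> in every
  characteristic.
\<close>

lemma ex_bimult_commutator_shift:
  obtains X Y where "X \<in> bimult" "Y \<in> bimult"
    "\<And>i. Suc i < n \<Longrightarrow> op_commutator X Y (v i) = v (Suc i)"
proof -
  have ex: "\<exists>T\<in>bimult. \<forall>i<n. T (v i) = g i" for g
  proof -
    obtain T where T: "T \<in> bimult" "\<forall>b\<in>v ` {..<n}. T b = g (the_inv_into {..<n} v b)"
      using bimult_interpolate[OF _ independent_v, of "\<lambda>b. g (the_inv_into {..<n} v b)"] by auto
    then have "T (v i) = g i" if "i < n" for i
      using that by (simp add: the_inv_into_f_f[OF inj_v])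
    with T(1) show ?thesis
      by (intro bexI[of _ T]) auto
  qed
  obtain X where X: "X \<in> bimult" "\<And>i. i < n \<Longrightarrow> X (v i) = v i * of_nat i"
    using ex[of "\<lambda>i. v i * of_nat i"] by auto
  \<comment> \<open>For the last index, \<open>v (Suc i)\<close> is outside the basis; the claim
    only concerns \<open>Suc i < n\<close>.\<close>
  obtain Y where Y: "Y \<in> bimult" "\<And>i. i < n \<Longrightarrow> Y (v i) = v (Suc i)"
    using ex[of "\<lambda>i. v (Suc i)"] by auto
  have "Y (x * of_nat i) = Y x * of_nat i" for x i
    using rlinear_simps(5)[OF bimult_rlinear[OF Y(1)], of x "of_nat i"] by simp
  \<comment> \<open>The diagonal entries at \<open>Suc i\<close> and \<open>i\<close> differ by
    1.\<close>
  then have "op_commutator X Y (v i) = v (Suc i)" if "Suc i < n" for i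
    using that by (simp add: op_commutator_def X Y distrib_left)
  with X(1) Y(1) show thesis
    by (rule that)
qed

lemma krylov_det_shift:
  assumes "n > 0" "\<And>i. Suc i < n \<Longrightarrow> C (v i) = v (Suc i)"
  shows "krylov_det C = 1"
proof -
  have "(C ^^ i) (v 0) = v i" if "i < n" for i
    using that by (induction i) (simp_all add: assms(2))
  then have "mat n n (\<lambda>(i, j). coord j ((C ^^ i) (v 0))) = 1\<^sub>m n"
    by (intro eq_matI) (simp_all add: coord_basis)
  then show ?thesis
    by (simp add: krylov_det_def)
qed

text \<open>The inverse of the Krylov matrix expresses the basis in terms of the vectors
  \<open>c ^ i * v 0\<close>; its row \<open>j\<close> gives the coefficients of
  \<open>v j\<close>.\<close>

lemma krylov_det_span:
  assumes "krylov_det (\<lambda>x. c * x) \<noteq> 0"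
  shows "rvs.span (range (\<lambda>i. c ^ i * v 0)) = UNIV"
proof -
  let ?w = "\<lambda>i. c ^ i * v 0"
  define M where "M = mat n n (\<lambda>(i, j). coord j (?w i))"
  have "((\<lambda>x. c * x) ^^ i) x = c ^ i * x" for i x
    by (induction i) (simp_all add: mult.assoc)
  then have "det M \<noteq> 0"
    using assms by (simp add: krylov_det_def M_def)
  moreover have M: "M \<in> carrier_mat n n"
    by (simp add: M_def)
  ultimately obtain B where B: "B \<in> carrier_mat n n" "B * M = 1\<^sub>m n"
    using det_non_zero_imp_unit[of M n] unfolding Units_def ring_mat_def by auto
  have "v j \<in> rvs.span (range ?w)" if j: "j < n" for j
  proof -
    have "v j = (\<Sum>i<n. ?w i * of_maxfield (B $$ (j, i)))"
    proof (rule coord_eqI)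
      fix l assume l: "l < n"
      have "coord l (\<Sum>i<n. ?w i * of_maxfield (B $$ (j, i))) = (\<Sum>i<n. B $$ (j, i) * M $$ (i, l))"
        using l by (simp add: coord_sum coord_scale M_def)
      also have "\<dots> = (B * M) $$ (j, l)"
        using j l B(1) M by (simp add: scalar_prod_def atLeast0LessThan)
      also have "\<dots> = coord l (v j)"
        using j l by (simp add: B(2) coord_basis)
      finally show "coord l (v j) = coord l (\<Sum>i<n. ?w i * of_maxfield (B $$ (j, i)))" ..
    qed
    also have "\<dots> = (\<Sum>i<n. rscale (B $$ (j, i)) (?w i))"
      by (simp add: rscale_def)
    also have "\<dots> \<in> rvs.span (range ?w)"
      by (intro rvs.span_sum rvs.span_scale rvs.span_base rangeI)
    finally show ?thesis .
  qed
  then have "rvs.span (v ` {..<n}) \<subseteq> rvs.span (range ?w)"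
    by (intro rvs.span_minimal) auto
  then show ?thesis
    by (simp add: span_v top_unique)
qed

text \<open>Both operators are replaced in turn by left multiplications, starting from the shift,
  whose determinant is 1.\<close>

lemma ex_cyclic_commutator:
  assumes inf: "infinite (ring_center :: 'a set)"
  shows "\<exists>x y. rvs.span (range (\<lambda>i. (x * y - y * x) ^ i * v 0)) = UNIV"
proof -
  have "n > 0"
  proof (rule ccontr)
    assume "\<not> n > 0"
    then have "(1 :: 'a) \<in> rvs.span {}"
      using span_v by simp
    then show False
      by simp
  qed
  have rlinear_0: "rlinear (\<lambda>x. 0)"
    by (rule rlinearI) simp_all
  obtain X Y where XY: "X \<in> bimult" "Y \<in> bimult"
    "\<And>i. Suc i < n \<Longrightarrow> op_commutator X Y (v i) = v (Suc i)"
    by (rule ex_bimult_commutator_shift) (rule that)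
  then have "krylov_det (op_commutator (\<lambda>x. 0 + X x) Y) \<noteq> 0"
    using krylov_det_shift[OF \<open>n > 0\<close>, of "op_commutator X Y"] by simp
  from krylov_det_bimult[OF inf XY(1) rlinear_0 bimult_rlinear[OF XY(2)] this]
  obtain y where "krylov_det (op_commutator (\<lambda>x. 0 + y * x) Y) \<noteq> 0" ..
  \<comment> \<open>Antisymmetry brings \<open>Y\<close> into the first slot, the one that
    \<open>krylov_det_bimult\<close> specializes; the sign goes to \<open>y\<close>.\<close>
  moreover have "op_commutator (\<lambda>x. 0 + y * x) Y = op_commutator (\<lambda>x. 0 + Y x) (\<lambda>x. - y * x)"
    by (simp add: op_commutator_def rlinear_simps[OF bimult_rlinear[OF XY(2)]])
  ultimately have "krylov_det (op_commutator (\<lambda>x. 0 + Y x) (\<lambda>x. - y * x)) \<noteq> 0"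
    by simp
  from krylov_det_bimult[OF inf XY(2) rlinear_0 rlinear_mult_left this]
  obtain x where "krylov_det (op_commutator (\<lambda>z. 0 + x * z) (\<lambda>z. - y * z)) \<noteq> 0" ..
  moreover have "op_commutator (\<lambda>z. 0 + x * z) (\<lambda>z. - y * z) = (\<lambda>z. (x * (- y) - (- y) * x) * z)"
    by (simp add: op_commutator_def algebra_simps)
  ultimately have "rvs.span (range (\<lambda>i. (x * (- y) - (- y) * x) ^ i * v 0)) = UNIV"
    by (intro krylov_det_span) simp
  then show ?thesis
    by (intro exI)
qed

end

subsection \<open>Finite fields\<close>

text \<open>The cyclicity of the multiplicative group is transferred from a ring record
  \<open>R\<close> whose carrier is the whole type.\<close>

lemma finite_field_generator:
  assumes "finite (UNIV :: 'k::field set)"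
  obtains a :: "'k::field" where "a \<noteq> 0" "\<And>x. x \<noteq> 0 \<Longrightarrow> \<exists>i. x = a ^ i"
proof -
  define R :: "'k ring" where "R = \<lparr>carrier = UNIV, monoid.mult = (*), one = 1, ring.zero = 0, add = (+)\<rparr>"
  have "\<exists>y. y + x = 0" "\<exists>y. x + y = 0" for x :: 'k
    by (intro exI[of _ "- x"]; simp)+
  moreover have "\<exists>y. y * x = 1 \<and> x * y = 1" if "x \<noteq> 0" for x :: 'k
    using that by (intro exI[of _ "inverse x"]) simp
  ultimately interpret R: field R
    by unfold_locales (auto simp: R_def Units_def algebra_simps)
  have pow: "x [^]\<^bsub>R\<^esub> (i::nat) = x ^ i" for x i
    by (induction i) (simp_all add: R_def nat_pow_def)
  obtain a where a: "a \<in> carrier (mult_of R)" "carrier (mult_of R) = {a [^]\<^bsub>R\<^esub> i | i::nat. i \<in> UNIV}"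
    using R.finite_field_mult_group_has_gen assms by (auto simp: R_def)
  show thesis
  proof (rule that)
    show "a \<noteq> 0"
      using a(1) by (simp add: R_def)
    show "\<exists>i. x = a ^ i" if "x \<noteq> 0" for x
    proof -
      have "x \<in> carrier (mult_of R)"
        using that by (simp add: R_def)
      then show ?thesis
        unfolding a(2) pow by blast
    qed
  qed
qed

section \<open>Powers of the Frobenius map\<close>

context
  fixes p :: nat
  assumes finite_UNIV: "finite (UNIV :: 'k::field set)" and p_def: "p = CHAR('k)"
begin

lemma prime_CHAR_finite: "prime CHAR('k)"
  using prime_CHAR_semidom[where ?'a = 'k] finite_imp_CHAR_pos[OF finite_UNIV] by simp

lemma frobenius_inj: "x ^ (p ^ i) = y ^ (p ^ i) \<longleftrightarrow> x = (y :: 'k)"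
proof
  assume eq: "x ^ (p ^ i) = y ^ (p ^ i)"
  have "(x - y) ^ (p ^ i) + y ^ (p ^ i) = x ^ (p ^ i)"
    using freshmans_dream'[OF prime_CHAR_finite, of "p ^ i" i "x - y" y] by (simp add: p_def)
  then show "x = y"
    by (simp add: eq)
qed simp

text \<open>The polynomial \<open>q\<close>, which is X^p - X, has at most \<open>p\<close> roots,
  and the \<open>p\<close> elements of the prime field are roots already.\<close>

lemma frobenius_fixed:
  assumes "x ^ p = (x :: 'k)"
  shows "x \<in> range of_nat"
proof -
  define q where "q = monom 1 p - monom (1 :: 'k) 1"
  have p1: "p > 1"
    using prime_gt_1_nat[OF prime_CHAR_finite] by (simp add: p_def)
  have "coeff q p = 1"
    using p1 by (simp add: q_def)
  then have "q \<noteq> 0"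
    by auto
  have "degree q \<le> p"
    unfolding q_def using p1 by (intro degree_diff_le) (simp_all add: degree_monom_eq)
  with \<open>q \<noteq> 0\<close> have card_le: "card {x. poly q x = 0} \<le> p" and fin: "finite {x. poly q x = 0}"
    using card_poly_roots_bound[of q] poly_roots_finite[of q] by auto
  have "of_nat i ^ p = (of_nat i :: 'k)" for i
  proof (induction i)
    case (Suc i)
    then show ?case
      using freshmans_dream[OF prime_CHAR_finite p_def, of 1 "of_nat i"] by simp
  qed (use p1 in simp)
  then have sub: "of_nat ` {..<p} \<subseteq> {x. poly q x = 0}"
    by (auto simp: q_def poly_monom)
  have "inj_on (of_nat :: nat \<Rightarrow> 'k) {..<p}"
  proof (rule linorder_inj_onI')
    fix i j assume "i \<in> {..<p}" "j \<in> {..<p}" "i < j"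
    then have "(of_nat (j - i) :: 'k) \<noteq> 0"
      unfolding of_nat_eq_0_iff_char_dvd p_def[symmetric] by (auto dest: dvd_imp_le)
    with \<open>i < j\<close> show "(of_nat i :: 'k) \<noteq> of_nat j"
      by (simp add: of_nat_diff)
  qed
  then have "card (of_nat ` {..<p} :: 'k set) = p"
    by (simp add: card_image)
  with sub card_le fin have "of_nat ` {..<p} = {x. poly q x = 0}"
    by (intro card_seteq) simp_all
  moreover have "poly q x = 0"
    using assms by (simp add: q_def poly_monom)
  ultimately show ?thesis
    by blast
qed

text \<open>Raising to the power \<open>p\<close> permutes the orbit of \<alpha>, so applying it to
  the coefficients of \<open>g\<close> fixes \<open>g\<close>; fixed coefficients lie in the prime
  field.\<close>

lemma frobenius_orbit_poly:
  fixes \<alpha> :: 'k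
  defines "g \<equiv> \<Prod>r\<in>range (\<lambda>j. \<alpha> ^ (p ^ j)). [:- r, 1:]"
  shows "coeff g i \<in> range of_nat" "poly g \<alpha> = 0"
proof -
  let ?R = "range (\<lambda>j. \<alpha> ^ (p ^ j))"
  have fin: "finite ?R"
    by (rule finite_subset[OF subset_UNIV finite_UNIV])
  have p0: "p > 0"
    using prime_gt_0_nat[OF prime_CHAR_finite] by (simp add: p_def)
  define F where "F = map_poly (\<lambda>x :: 'k. x ^ p)"
  have coeff_F: "coeff (F q) n = coeff q n ^ p" for q n
    using p0 by (simp add: F_def coeff_map_poly)
  have F_mult: "F (q * r) = F q * F r" for q r
    by (rule poly_eqI)
       (simp only: coeff_F coeff_mult freshmans_dream_sum[OF prime_CHAR_finite p_def] power_mult_distrib)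
  have F_1: "F 1 = 1"
    by (simp add: F_def)
  have F_prod: "F (\<Prod>r\<in>S. f r) = (\<Prod>r\<in>S. F (f r))" for S :: "'k set" and f
    by (induction S rule: infinite_finite_induct) (simp_all add: F_1 F_mult)
  have "(- r) ^ p = - (r ^ p)" for r :: 'k
    by (rule minus_power_prime_CHAR[OF p_def]) (simp add: p_def prime_CHAR_finite)
  then have F_lin: "F [:- r, 1:] = [:- (r ^ p), 1:]" for r
    using p0 by (simp add: F_def map_poly_pCons)
  have inj: "inj_on (\<lambda>x. x ^ p) ?R"
    using frobenius_inj[of _ 1] by (intro inj_onI) simp
  have "(\<lambda>x. x ^ p) ` ?R \<subseteq> ?R"
  proof (clarify, rule range_eqI)
    show "(\<alpha> ^ (p ^ j)) ^ p = \<alpha> ^ (p ^ Suc j)" for j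
      by (simp only: power_Suc2 power_mult)
  qed
  then have im: "(\<lambda>x. x ^ p) ` ?R = ?R"
    by (rule endo_inj_surj[OF fin _ inj])
  have "F g = (\<Prod>r\<in>?R. [:- (r ^ p), 1:])"
    by (simp add: g_def F_prod F_lin)
  also have "\<dots> = (\<Prod>r\<in>(\<lambda>x. x ^ p) ` ?R. [:- r, 1:])"
    by (simp add: prod.reindex[OF inj])
  also have "\<dots> = g"
    unfolding im g_def ..
  finally have "coeff g i ^ p = coeff g i"
    using coeff_F[of g i] by simp
  then show "coeff g i \<in> range of_nat"
    by (rule frobenius_fixed)
  have "\<alpha> \<in> ?R"
    by (rule range_eqI[of _ _ 0]) simp
  then show "poly g \<alpha> = 0"
    unfolding g_def poly_prod using fin by (intro prod_zero) auto
qed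

text \<open>Two members of the orbit coincide by finiteness, and injectivity of the Frobenius powers
  cancels the smaller exponent.\<close>

lemma frobenius_periodic:
  fixes \<alpha> :: 'k
  shows "\<exists>j>0. \<alpha> ^ (p ^ j) = \<alpha>"
proof -
  have "\<not> inj (\<lambda>j. \<alpha> ^ (p ^ j))"
  proof
    assume "inj (\<lambda>j. \<alpha> ^ (p ^ j))"
    then have "finite (UNIV :: nat set)"
      using finite_UNIV finite_imageD finite_subset subset_UNIV by metis
    then show False
      by simp
  qed
  then have "\<exists>i j. i \<noteq> j \<and> \<alpha> ^ (p ^ i) = \<alpha> ^ (p ^ j)"
    by (auto simp: inj_def)
  then obtain i j where ij: "i < j" "\<alpha> ^ (p ^ i) = \<alpha> ^ (p ^ j)"
    by (metis linorder_neqE_nat)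
  have "(\<alpha> ^ (p ^ (j - i))) ^ (p ^ i) = \<alpha> ^ (p ^ j)"
    using ij(1) by (simp flip: power_mult power_add)
  then have "(\<alpha> ^ (p ^ (j - i))) ^ (p ^ i) = \<alpha> ^ (p ^ i)"
    using ij(2) by simp
  then have "\<alpha> ^ (p ^ (j - i)) = \<alpha>"
    by (simp only: frobenius_inj)
  with ij(1) show ?thesis
    by (intro exI[of _ "j - i"]) simp
qed

end

subsection \<open>Eigenspaces of \<open>x \<mapsto> a x\<close> over \<open>K\<close>\<close>

text \<open>The polynomial \<open>q\<close> evaluated at the operator of left multiplication by
  \<open>a\<close>, with coefficients acting from the right.\<close>

definition poly_left :: "'a::division_ring \<Rightarrow> 'a maxfield poly \<Rightarrow> 'a \<Rightarrow> 'a" where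
  "poly_left a q x = (\<Sum>i\<le>degree q. a ^ i * x * of_maxfield (coeff q i))"

lemma poly_left_eq:
  assumes "degree q \<le> m"
  shows "poly_left a q x = (\<Sum>i\<le>m. a ^ i * x * of_maxfield (coeff q i))"
  unfolding poly_left_def
  using assms by (intro sum.mono_neutral_left) (auto simp: coeff_eq_0)

lemma poly_left_linear_factor:
  "poly_left a ([:- r, 1:] * q) x = poly_left a q (a * x - x * of_maxfield r)"
proof -
  let ?m = "degree q"
  have comm: "of_maxfield r * of_maxfield k = of_maxfield k * of_maxfield r" for k
    by (metis mult.commute times_maxfield.rep_eq)
  have eq: "[:- r, 1:] * q = pCons 0 q - smult r q"
    by simp
  have "degree ([:- r, 1:] * q) \<le> Suc ?m"
    by (rule order_trans[OF degree_mult_le]) simp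
  then have "poly_left a ([:- r, 1:] * q) x =
      (\<Sum>i\<le>Suc ?m. a ^ i * x * of_maxfield (coeff (pCons 0 q) i)) -
      (\<Sum>i\<le>Suc ?m. a ^ i * x * of_maxfield (r * coeff q i))"
    unfolding sum_subtractf[symmetric]
    by (subst poly_left_eq) (simp_all only: eq coeff_diff coeff_smult minus_maxfield.rep_eq right_diff_distrib)
  also have "(\<Sum>i\<le>Suc ?m. a ^ i * x * of_maxfield (coeff (pCons 0 q) i)) =
      (\<Sum>i\<le>?m. a ^ i * (a * x) * of_maxfield (coeff q i))"
    by (subst sum.atMost_Suc_shift) (simp add: mult.assoc power_Suc2 del: power_Suc)
  also have "(\<Sum>i\<le>Suc ?m. a ^ i * x * of_maxfield (r * coeff q i)) =
      (\<Sum>i\<le>?m. a ^ i * (x * of_maxfield r) * of_maxfield (coeff q i))"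
    by (simp add: coeff_eq_0 mult.assoc)
  also have "(\<Sum>i\<le>?m. a ^ i * (a * x) * of_maxfield (coeff q i)) -
      (\<Sum>i\<le>?m. a ^ i * (x * of_maxfield r) * of_maxfield (coeff q i)) =
      poly_left a q (a * x - x * of_maxfield r)"
    by (simp only: poly_left_def sum_subtractf[symmetric] right_diff_distrib left_diff_distrib)
  finally show ?thesis .
qed

text \<open>The union of the eigenspaces for the values in \<open>S\<close>; their sum is its
  span.\<close>

definition eigenvectors :: "'a::division_ring \<Rightarrow> 'a maxfield set \<Rightarrow> 'a set" where
  "eigenvectors a S = {x. \<exists>r\<in>S. a * x = x * of_maxfield r}"

text \<open>On an eigenvector for \<open>s\<close> the operator acts as right multiplication by
  \<open>s - r\<close>, which is invertible because \<open>r\<close> is not in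
  \<open>S\<close>.\<close>

lemma span_eigenvectors_solve:
  assumes "y \<in> rvs.span (eigenvectors a S)" "r \<notin> S"
  shows "\<exists>z\<in>rvs.span (eigenvectors a S). a * z - z * of_maxfield r = y"
  using assms(1)
proof (induction rule: rvs.span_induct_alt)
  case base
  show ?case
    by (intro bexI[of _ 0]) (simp_all add: rvs.span_zero)
next
  case (step k u y)
  then obtain s z where s: "s \<in> S" "a * u = u * of_maxfield s"
    and z: "z \<in> rvs.span (eigenvectors a S)" "a * z - z * of_maxfield r = y"
    by (auto simp: eigenvectors_def)
  define h where "h = k / (s - r)"
  have "s - r \<noteq> 0"
    using s(1) assms(2) by auto
  then have "(s - r) * h = k"
    by (simp add: h_def)
  then have "of_maxfield s * of_maxfield h - of_maxfield h * of_maxfield r = of_maxfield k"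
    by (metis left_diff_distrib minus_maxfield.rep_eq mult.commute times_maxfield.rep_eq)
  then have "u * (of_maxfield s * of_maxfield h - of_maxfield h * of_maxfield r) = u * of_maxfield k"
    by simp
  moreover have "a * (u * of_maxfield h) = u * (of_maxfield s * of_maxfield h)"
    by (simp add: s(2) flip: mult.assoc)
  ultimately have "a * rscale h u - rscale h u * of_maxfield r = rscale k u"
    by (simp add: rscale_def right_diff_distrib mult.assoc)
  then have "a * (rscale h u + z) - (rscale h u + z) * of_maxfield r = rscale k u + y"
    unfolding z(2)[symmetric] by (simp add: distrib_left distrib_right algebra_simps)
  moreover have "rscale h u + z \<in> rvs.span (eigenvectors a S)"
    using step(1) z(1) by (intro rvs.span_add rvs.span_scale) (auto intro: rvs.span_base)
  ultimately show ?case
    by blast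
qed

text \<open>An operator killed by a product of distinct linear factors is diagonalizable.
  Inductively \<open>a * x - x * of_maxfield r\<close> lies in the span for \<open>S\<close>;
  solving for it there by \<open>z\<close> makes \<open>x - z\<close> an eigenvector for
  \<open>r\<close>.\<close>

lemma span_eigenvectors:
  assumes "finite S" "poly_left a (\<Prod>r\<in>S. [:- r, 1:]) x = 0"
  shows "x \<in> rvs.span (eigenvectors a S)"
  using assms
proof (induction S arbitrary: x rule: finite_induct)
  case empty
  then show ?case
    by (simp add: poly_left_def rvs.span_zero)
next
  case (insert r S)
  have "poly_left a (\<Prod>r\<in>S. [:- r, 1:]) (a * x - x * of_maxfield r) = 0"
    unfolding poly_left_linear_factor[symmetric]
      prod.insert[OF insert.hyps, of "\<lambda>r. [:- r, 1:]", symmetric]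
    by (rule insert.prems)
  then have "a * x - x * of_maxfield r \<in> rvs.span (eigenvectors a S)"
    by (rule insert.IH)
  then obtain z where z: "z \<in> rvs.span (eigenvectors a S)"
    "a * z - z * of_maxfield r = a * x - x * of_maxfield r"
    using span_eigenvectors_solve insert.hyps(2) by blast
  have "a * (x - z) = (x - z) * of_maxfield r"
    using z(2) by (simp add: algebra_simps)
  then have "x - z \<in> rvs.span (eigenvectors a (insert r S))"
    by (intro rvs.span_base) (auto simp: eigenvectors_def)
  moreover have "z \<in> rvs.span (eigenvectors a (insert r S))"
    using z(1) by (rule rvs.span_mono[THEN subsetD, rotated]) (auto simp: eigenvectors_def)
  ultimately have "x - z + z \<in> rvs.span (eigenvectors a (insert r S))"
    by (rule rvs.span_add)
  then show ?case
    by simp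
qed

subsection \<open>Cyclic vectors of commutators over a finite center\<close>

lemma of_maxfield_sum: "of_maxfield (sum f I) = (\<Sum>i\<in>I. of_maxfield (f i))"
  by (induction I rule: infinite_finite_induct) simp_all

text \<open>The relation is multiplicative in \<open>k\<close>, and powers of \<alpha> exhaust the
  nonzero elements; \<open>q > 0\<close> settles \<open>k = 0\<close>.\<close>

lemma of_maxfield_conjugate:
  assumes \<alpha>: "\<And>k. k \<noteq> 0 \<Longrightarrow> \<exists>i. k = \<alpha> ^ i" and q: "q > 0"
    and u: "of_maxfield \<alpha> * u = u * of_maxfield (\<alpha> ^ q)"
  shows "of_maxfield k * u = u * of_maxfield (k ^ q)"
proof (cases "k = 0")
  case False
  have "of_maxfield (\<alpha> ^ i) * u = u * of_maxfield ((\<alpha> ^ i) ^ q)" for i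
  proof (induction i)
    case (Suc i)
    have "of_maxfield (\<alpha> ^ Suc i) * u = of_maxfield \<alpha> * (of_maxfield (\<alpha> ^ i) * u)"
      by (simp add: mult.assoc)
    also have "\<dots> = of_maxfield \<alpha> * u * of_maxfield ((\<alpha> ^ i) ^ q)"
      by (simp only: Suc mult.assoc)
    also have "\<dots> = u * of_maxfield ((\<alpha> ^ Suc i) ^ q)"
      by (simp only: u mult.assoc times_maxfield.rep_eq[symmetric] power_Suc power_mult_distrib)
    finally show ?case .
  qed simp
  with \<alpha>[OF False] show ?thesis
    by metis
qed (use q in simp)

text \<open>The orbit polynomial has coefficients in the prime field, which are central. Evaluated
  at left multiplication by \<alpha> it is therefore left multiplication by its value at \<alpha>,
  which is 0.\<close>

lemma span_frobenius_eigenvectors: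
  fixes \<alpha> :: "'a::division_ring maxfield"
  assumes fin: "finite (UNIV :: 'a maxfield set)" and p: "p = CHAR('a maxfield)"
  shows "rvs.span (eigenvectors (of_maxfield \<alpha>) (range (\<lambda>j. \<alpha> ^ (p ^ j)))) = UNIV"
proof -
  let ?R = "range (\<lambda>j. \<alpha> ^ (p ^ j))"
  let ?g = "\<Prod>r\<in>?R. [:- r, 1:]"
  have "poly_left (of_maxfield \<alpha>) ?g x = of_maxfield (poly ?g \<alpha>) * x" for x
  proof -
    have "of_maxfield \<alpha> ^ i * x * of_maxfield (coeff ?g i) =
        of_maxfield (coeff ?g i * \<alpha> ^ i) * x" for i
    proof -
      obtain n where "coeff ?g i = of_nat n"
        using frobenius_orbit_poly(1)[OF fin p, of \<alpha> i] by blast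
      then show ?thesis
        by (simp only: of_maxfield_of_nat times_maxfield.rep_eq of_maxfield_power
            mult_of_nat_commute mult.assoc)
    qed
    then show ?thesis
      by (simp only: poly_left_def poly_altdef of_maxfield_sum sum_distrib_right)
  qed
  then have "poly_left (of_maxfield \<alpha>) ?g x = 0" for x
    by (simp only: frobenius_orbit_poly(2)[OF fin p]) simp
  then have "x \<in> rvs.span (eigenvectors (of_maxfield \<alpha>) ?R)" for x
    by (intro span_eigenvectors finite_subset[OF subset_UNIV fin])
  then show ?thesis
    by blast
qed

text \<open>Take \<open>u\<close> with the least positive exponent \<open>m\<close>. Dividing an
  eigenvector by \<open>u\<close> on the right lowers its exponent by \<open>m\<close>; the descent
  ends at 0 or at exponent 0, where the vector commutes with K and so lies in K.\<close>

lemma ex_frobenius_generator: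
  fixes \<alpha> :: "'a::division_ring maxfield"
  assumes fin: "finite (UNIV :: 'a maxfield set)" and p: "p = CHAR('a maxfield)"
    and \<alpha>: "\<And>k. k \<noteq> 0 \<Longrightarrow> \<exists>i. k = \<alpha> ^ i"
  obtains u m where "u \<noteq> 0" "of_maxfield \<alpha> * u = u * of_maxfield (\<alpha> ^ (p ^ m))"
    and "\<And>j x. of_maxfield \<alpha> * x = x * of_maxfield (\<alpha> ^ (p ^ j)) \<Longrightarrow> \<exists>i k. x = u ^ i * of_maxfield k"
proof -
  define a where "a = of_maxfield \<alpha>"
  have p0: "p > 0"
    unfolding p by (rule finite_imp_CHAR_pos[OF fin])
  define J where "J = (\<lambda>j. j > 0 \<and> (\<exists>x. x \<noteq> 0 \<and> a * x = x * of_maxfield (\<alpha> ^ (p ^ j))))"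
  \<comment> \<open>By periodicity the eigenvector 1 has a positive exponent, so the least one
    exists.\<close>
  obtain j where "j > 0" "\<alpha> ^ (p ^ j) = \<alpha>"
    using frobenius_periodic[OF fin p] by blast
  then have "J j"
    unfolding J_def by (intro conjI exI[of _ 1]) (simp_all add: a_def)
  define m where "m = (LEAST j. J j)"
  have "J m"
    unfolding m_def by (rule LeastI) fact
  then have "m > 0" and "\<exists>u. u \<noteq> 0 \<and> a * u = u * of_maxfield (\<alpha> ^ (p ^ m))"
    by (simp_all add: J_def)
  then obtain u where u: "u \<noteq> 0" "a * u = u * of_maxfield (\<alpha> ^ (p ^ m))"
    by blast
  have conj: "of_maxfield k * u = u * of_maxfield (k ^ (p ^ m))" for k
    by (rule of_maxfield_conjugate[OF \<alpha>]) (use u p0 in \<open>simp_all add: a_def\<close>)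
  have "\<exists>i k. x = u ^ i * of_maxfield k" if "a * x = x * of_maxfield (\<alpha> ^ (p ^ j))" for j x
    using that
  proof (induction j arbitrary: x rule: less_induct)
    case (less j)
    consider "x = 0" | "j = 0" | "x \<noteq> 0" "j > 0"
      by blast
    then show ?case
    proof cases
      case 1
      then show ?thesis
        by (intro exI[of _ 0]) simp
    next
      case 2
      then have "of_maxfield \<alpha> * x = x * of_maxfield (\<alpha> ^ 1)"
        using less.prems by (simp add: a_def)
      from of_maxfield_conjugate[OF \<alpha> _ this] have "x * of_maxfield k = of_maxfield k * x" for k
        by simp
      then obtain h where "x = of_maxfield h"
        using ex_of_maxfield by blast
      then show ?thesis
        by (intro exI[of _ 0] exI[of _ h]) simp
    next
      case 3
      then have "J j"
        unfolding J_def using less.prems by blast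
      then have "m \<le> j"
        unfolding m_def by (rule Least_le)
      define \<beta> where "\<beta> = \<alpha> ^ (p ^ (j - m))"
      have \<beta>: "\<beta> ^ (p ^ m) = \<alpha> ^ (p ^ j)"
        using \<open>m \<le> j\<close> by (simp add: \<beta>_def flip: power_mult power_add)
      define y where "y = x * inverse u"
      have x: "x = y * u"
        using u(1) by (simp add: y_def mult.assoc)
      have "a * y * u = y * u * of_maxfield (\<beta> ^ (p ^ m))"
        using less.prems by (simp only: x \<beta> mult.assoc)
      also have "\<dots> = y * of_maxfield \<beta> * u"
        by (simp only: conj mult.assoc)
      finally have "a * y = y * of_maxfield \<beta>"
        using u(1) by simp
      moreover have "j - m < j"
        using \<open>m > 0\<close> 3(2) by simp
      ultimately obtain i k where "y = u ^ i * of_maxfield k"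
        using less.IH[of "j - m" y] unfolding \<beta>_def by blast
      then have "x = u ^ Suc i * of_maxfield (k ^ (p ^ m))"
        by (simp only: x conj mult.assoc power_Suc2)
      then show ?thesis
        by (intro exI)
    qed
  qed
  with u show thesis
    using that unfolding a_def by blast
qed

text \<open>If \<open>c ^ i\<close> is \<open>u ^ i\<close> times a nonzero element of K for each
  \<open>i\<close>, the powers of \<open>c\<close> span every \<open>u ^ i * of_maxfield k\<close>,
  hence all eigenvectors, hence D.\<close>

lemma ex_cyclic_commutator_finite:
  assumes fin: "finite (UNIV :: 'a::division_ring maxfield set)"
  shows "\<exists>x y v :: 'a. rvs.span (range (\<lambda>i. (x * y - y * x) ^ i * v)) = UNIV"
proof -
  define p where "p = CHAR('a maxfield)"
  obtain \<alpha> :: "'a maxfield" where \<alpha>: "\<And>k. k \<noteq> 0 \<Longrightarrow> \<exists>i. k = \<alpha> ^ i"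
    using finite_field_generator[OF fin] by blast
  obtain u m where u: "u \<noteq> 0" "of_maxfield \<alpha> * u = u * of_maxfield (\<alpha> ^ (p ^ m))"
    and ui: "\<And>j x. of_maxfield \<alpha> * x = x * of_maxfield (\<alpha> ^ (p ^ j)) \<Longrightarrow>
      \<exists>i k. x = u ^ i * of_maxfield k"
    using ex_frobenius_generator[OF fin p_def \<alpha>] by blast
  have "p > 0"
    unfolding p_def by (rule finite_imp_CHAR_pos[OF fin])
  then have conj: "of_maxfield k * u = u * of_maxfield (k ^ (p ^ m))" for k
    by (intro of_maxfield_conjugate[OF \<alpha> _ u(2)]) simp_all
  have span: "rvs.span (range (\<lambda>i. c ^ i * 1)) = UNIV"
    if c: "\<And>i k. u ^ i * of_maxfield k \<in> rvs.span (range (\<lambda>i. c ^ i * 1))" for c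
  proof -
    have "eigenvectors (of_maxfield \<alpha>) (range (\<lambda>j. \<alpha> ^ (p ^ j))) \<subseteq> rvs.span (range (\<lambda>i. c ^ i * 1))"
    proof
      fix x assume "x \<in> eigenvectors (of_maxfield \<alpha>) (range (\<lambda>j. \<alpha> ^ (p ^ j)))"
      then obtain i k where "x = u ^ i * of_maxfield k"
        using ui unfolding eigenvectors_def by blast
      then show "x \<in> rvs.span (range (\<lambda>i. c ^ i * 1))"
        using c by simp
    qed
    then have "rvs.span (eigenvectors (of_maxfield \<alpha>) (range (\<lambda>j. \<alpha> ^ (p ^ j)))) \<subseteq>
        rvs.span (range (\<lambda>i. c ^ i * 1))"
      by (rule rvs.span_minimal) (rule rvs.subspace_span)
    then show ?thesis
      by (simp only: span_frobenius_eigenvectors[OF fin p_def] top_unique)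
  qed
  define g where "g = \<alpha> ^ (p ^ m) - \<alpha>"
  show ?thesis
  proof (cases "g = 0")
    case True
    then have "of_maxfield k * u = u * of_maxfield k" for k
      using of_maxfield_conjugate[OF \<alpha>, of 1 u k] u(2) by (simp add: g_def)
    then obtain h where h: "u = of_maxfield h"
      using ex_of_maxfield[of u] by metis
    \<comment> \<open>Here \<open>u\<close> lies in K, so D = K; the zero commutator has cyclic
      vector 1 because its power with exponent 0 is 1.\<close>
    have "u ^ i * of_maxfield k \<in> rvs.span (range (\<lambda>i. (0 * 0 - 0 * 0) ^ i * 1))" for i k
    proof -
      have "rscale (h ^ i * k) ((0 * 0 - 0 * 0) ^ 0 * 1) \<in> rvs.span (range (\<lambda>i. (0 * 0 - 0 * 0) ^ i * 1))"
        by (intro rvs.span_scale rvs.span_base rangeI)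
      then show ?thesis
        by (simp add: rscale_def h)
    qed
    from span[OF this] show ?thesis
      by (intro exI)
  next
    case False
    define c where "c = of_maxfield \<alpha> * u - u * of_maxfield \<alpha>"
    have c: "c = u * of_maxfield g"
      by (simp only: c_def g_def u(2) minus_maxfield.rep_eq right_diff_distrib)
    have ci: "\<exists>h. h \<noteq> 0 \<and> c ^ i = u ^ i * of_maxfield h" for i
    proof (induction i)
      case 0
      show ?case
        by (intro exI[of _ 1]) simp
    next
      case (Suc i)
      then obtain h where h: "h \<noteq> 0" "c ^ i = u ^ i * of_maxfield h"
        by blast
      \<comment> \<open>Moving the factor of K past \<open>u\<close> raises it to the power
        \<open>p ^ m\<close>, so it stays nonzero.\<close>
      have "c ^ Suc i = u ^ i * (of_maxfield h * u) * of_maxfield g"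
        by (simp only: power_Suc2 h(2)) (simp only: c mult.assoc)
      also have "\<dots> = u ^ Suc i * of_maxfield (h ^ (p ^ m) * g)"
        by (simp only: conj times_maxfield.rep_eq mult.assoc power_Suc2)
      finally show ?case
        using h(1) False by (intro exI[of _ "h ^ (p ^ m) * g"]) simp
    qed
    have "u ^ i * of_maxfield k \<in> rvs.span (range (\<lambda>i. c ^ i * 1))" for i k
    proof -
      obtain h where h: "h \<noteq> 0" "c ^ i = u ^ i * of_maxfield h"
        using ci by blast
      have "rscale (inverse h * k) (c ^ i * 1) \<in> rvs.span (range (\<lambda>i. c ^ i * 1))"
        by (intro rvs.span_scale rvs.span_base rangeI)
      also have "rscale (inverse h * k) (c ^ i * 1) = u ^ i * of_maxfield (h * (inverse h * k))"
        by (simp only: rscale_def h(2) times_maxfield.rep_eq mult.assoc mult_1_right)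
      also have "h * (inverse h * k) = k"
        using h(1) by simp
      finally show ?thesis .
    qed
    from span[OF this] show ?thesis
      unfolding c_def by (intro exI)
  qed
qed

subsection \<open>Central division algebras\<close>

text \<open>One more generator adds finitely many translates of the previous span.\<close>

lemma (in vector_space) finite_span:
  assumes "finite (UNIV :: 'a set)" "finite S"
  shows "finite (span S)"
  using assms(2)
proof (induction S rule: finite_induct)
  case (insert a S)
  have "span (insert a S) \<subseteq> (\<Union>k. (\<lambda>x. x + scale k a) ` span S)"
  proof
    fix x assume "x \<in> span (insert a S)"
    then obtain k where "x - scale k a \<in> span S"
      unfolding span_insert by blast
    then have "x \<in> (\<lambda>x. x + scale k a) ` span S"
      by (intro image_eqI[of _ _ "x - scale k a"]) simp_all
    then show "x \<in> (\<Union>k. (\<lambda>x. x + scale k a) ` span S)"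
      by blast
  qed
  then show ?case
    using insert.IH assms(1) finite_subset by blast
qed simp

context central_division_algebra
begin

lemma scale_eq_mult: "scale k x = x * scale k 1"
  using scale_mult_right[of k x 1] by simp

lemma finite_UNIV_if_finite_center:
  assumes "finite (ring_center :: 'a set)"
  shows "finite (UNIV :: 'a set)"
proof -
  have "inj (\<lambda>k. scale k (1 :: 'a))"
    by (rule injI) simp
  then have "finite (UNIV :: 'f set)"
    using assms unfolding center_eq by (rule finite_imageD[rotated])
  moreover obtain B where "finite_dimensional_vector_space scale B"
    using finite_dim by blast
  then interpret finite_dimensional_vector_space scale B .
  show ?thesis
    using finite_span[OF \<open>finite UNIV\<close> finite_Basis] by (simp add: span_Basis)
qed

text \<open>Scalars of F act through central elements, which lie in K. So the K-span of an F-basis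
  is an F-subspace and equals D, and the basis can be thinned out to a K-basis.\<close>

lemma ex_right_basis: "\<exists>(v :: nat \<Rightarrow> 'a) n. right_basis v n"
proof -
  obtain B where "finite_dimensional_vector_space scale B"
    using finite_dim by blast
  then interpret finite_dimensional_vector_space scale B .
  have "\<exists>h. scale k x = rscale h x" for k x
  proof -
    have "scale k 1 \<in> ring_center"
      unfolding center_eq by (rule rangeI)
    then obtain h where "scale k 1 = of_maxfield h"
      using ring_center_of_maxfield by blast
    then have "scale k x = rscale h x"
      using scale_eq_mult[of k x] by (simp only: rscale_def)
    then show ?thesis
      by (intro exI)
  qed
  then have "subspace (rvs.span B)"
    unfolding subspace_def by (metis rvs.span_add rvs.span_scale rvs.span_zero)
  then have "rvs.span B = UNIV"
    using span_minimal[OF rvs.span_superset, of B] by (simp add: span_Basis top_unique)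
  moreover obtain C where C: "C \<subseteq> B" "rvs.independent C" "B \<subseteq> rvs.span C"
    by (rule rvs.maximal_independent_subset)
  moreover have "rvs.span B \<subseteq> rvs.span C"
    using C(3) by (rule rvs.span_minimal) (rule rvs.subspace_span)
  ultimately have "rvs.span C = UNIV"
    by (simp add: top_unique)
  have "finite C"
    using C(1) finite_Basis by (rule finite_subset)
  then obtain v where "bij_betw v {0..<card C} C"
    using ex_bij_betw_nat_finite by blast
  then have "right_basis v (card C)"
    using C(2) \<open>rvs.span C = UNIV\<close>
    by unfold_locales (auto simp: bij_betw_def atLeast0LessThan)
  then show ?thesis
    by (intro exI)
qed

lemma ex_cyclic_vector: "\<exists>x y v :: 'a. rvs.span (range (\<lambda>i. (x * y - y * x) ^ i * v)) = UNIV"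
proof (cases "finite (ring_center :: 'a set)")
  case True
  then have "finite (UNIV :: 'a set)"
    by (rule finite_UNIV_if_finite_center)
  then have "finite (range (of_maxfield :: 'a maxfield \<Rightarrow> 'a))"
    by (rule finite_subset[OF subset_UNIV])
  then have "finite (UNIV :: 'a maxfield set)"
    by (rule finite_imageD) (simp add: inj_on_def of_maxfield_inject)
  then show ?thesis
    by (rule ex_cyclic_commutator_finite)
next
  case False
  obtain v n where "right_basis (v :: nat \<Rightarrow> 'a) n"
    using ex_right_basis by blast
  then show ?thesis
    using right_basis.ex_cyclic_commutator[OF _ False] by blast
qed

end

theorem theorem2p7:
  fixes scale :: "'f::field \<Rightarrow> 'a::division_ring \<Rightarrow> 'a"
  assumes "central_division_algebra scale"
  shows "\<exists>x y. is_maximal_subfield (central_division_algebra.adjoin scale (x * y - y * x))"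
proof -
  interpret central_division_algebra scale by fact
  obtain x y v where "rvs.span (range (\<lambda>i. (x * y - y * x :: 'a) ^ i * v)) = UNIV"
    using ex_cyclic_vector by blast
  from is_maximal_subfield_adjoin[OF this] show ?thesis
    by (intro exI)
qed

end
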